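(* Let $(K,v)$ be a valued field with valuation ring $\mathcal{O}_v$, and let $I,J$ be $\mathcal{O}_v$-ideals. Then $$IJ:I=\begin{cases}J\,\mathcal{O}(IJ)&\text{if }I\,\mathcal{O}(IJ)\text{ is a principal }\mathcal{O}(IJ)\text{-ideal},\\(J\,\mathcal{O}(IJ))^{\diamondsuit}&\text{if }I\,\mathcal{O}(IJ)\text{ is a nonprincipal }\mathcal{O}(IJ)\text{-ideal}.\end{cases}$$ In the special case where $\mathcal{O}(I)=\mathcal{O}(J)$, we have $\mathcal{O}(IJ)=\mathcal{O}(I)$, $I\,\mathcal{O}(IJ)=I$ and $J\,\mathcal{O}(IJ)=J$, so that $IJ:I=J$ if $I$ is a principal $\mathcal{O}(I)$-ideal, and $IJ:I=J^{\diamondsuit}$ otherwise.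
   Context: For a valuation ring $\mathcal{O}$ of $K$, an $\mathcal{O}$-ideal means a nonzero $\mathcal{O}$-submodule $I\subsetneq K$ (so fractional ideals are included). It is principal if it is of the form $a\mathcal{O}$ with $a\in K$, and nonprincipal otherwise. For $\mathcal{O}_v$-ideals, $I_2:I_1:=\{a\in K\mid aI_1\subseteq I_2\}$, and $IJ$ is the usual product of ideals. For an $\mathcal{O}_v$-ideal $I$, $\mathcal{O}(I):=\{b\in K\mid bI\subseteq I\}$; it is a valuation ring of $K$ containing $\mathcal{O}_v$, and $I$ is an $\mathcal{O}(I)$-ideal. For a valuation ring $\mathcal{O}\supseteq\mathcal{O}_v$ of $K$ with associated valuation $w$ and value group $wK$, and an $\mathcal{O}$-ideal $J$, put $wJ:=\{wb\mid 0\ne b\in J\}$ and define $\widehat J_{\mathcal{O}}:=a\mathcal{O}$ if there exists $a\in K$ such that $wa$ is the infimum of $wJ$ in $wK$, and $\widehat J_{\mathcal{O}}:=J$ otherwise. For an $\mathcal{O}_v$-ideal $J$, $J^{\diamondsuit}:=\widehat J_{\mathcal{O}(J)}$. *)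

theory Defs
  imports Complex_Main "HOL-Algebra.Order"
begin

text \<open>
  The field \<open>K\<close> is the universe of a type of class \<^class>\<open>field\<close>. The valuation takes values in
  an arbitrary ordered abelian group and need not be surjective, so the value group is the image of
  \<open>K - {0}\<close>. The convention \<open>v 0 = \<infinity>\<close> is encoded by leaving \<open>v 0\<close> unconstrained and never
  using it.
\<close>

definition valuation :: "('k::field \<Rightarrow> 'g::linordered_ab_group_add) \<Rightarrow> bool" where
  "valuation v \<longleftrightarrow>
     (\<forall>x y. x \<noteq> 0 \<longrightarrow> y \<noteq> 0 \<longrightarrow> v (x * y) = v x + v y) \<and>
     (\<forall>x y. x \<noteq> 0 \<longrightarrow> y \<noteq> 0 \<longrightarrow> x + y \<noteq> 0 \<longrightarrow> min (v x) (v y) \<le> v (x + y))"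

definition val_ring :: "('k::field \<Rightarrow> 'g::linordered_ab_group_add) \<Rightarrow> 'k set" where
  "val_ring v = {x. x = 0 \<or> 0 \<le> v x}"

definition frac_ideal :: "'k::field set \<Rightarrow> 'k set \<Rightarrow> bool" where
  "frac_ideal \<O> I \<longleftrightarrow>
     0 \<in> I \<and> (\<forall>x\<in>I. \<forall>y\<in>I. x + y \<in> I) \<and> (\<forall>c\<in>\<O>. \<forall>x\<in>I. c * x \<in> I) \<and>
     I \<noteq> {0} \<and> I \<noteq> UNIV"

definition principal :: "'k::field \<Rightarrow> 'k set \<Rightarrow> 'k set" where
  "principal a \<O> = {a * c | c. c \<in> \<O>}"

definition principal_ideal :: "'k::field set \<Rightarrow> 'k set \<Rightarrow> bool" where
  "principal_ideal \<O> I \<longleftrightarrow> frac_ideal \<O> I \<and> (\<exists>a. I = principal a \<O>)"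

definition ideal_mult :: "'k::field set \<Rightarrow> 'k set \<Rightarrow> 'k set"  (infixl \<open>\<cdot>\<close> 70) where
  "I \<cdot> J = {\<Sum>i<n. a i * b i | (n::nat) a b. \<forall>i<n. a i \<in> I \<and> b i \<in> J}"

definition ideal_quot :: "'k::field set \<Rightarrow> 'k set \<Rightarrow> 'k set" where
  "ideal_quot I2 I1 = {a. \<forall>x\<in>I1. a * x \<in> I2}"

definition invariance_ring :: "'k::field set \<Rightarrow> 'k set" where
  "invariance_ring I = {b. \<forall>x\<in>I. b * x \<in> I}"

text \<open>
  The valuation \<open>w\<close> associated with a valuation ring \<open>\<O>\<close> is the canonical one, with value group
  \<open>wK\<close> the quotient of \<open>K - {0}\<close> by the units of \<open>\<O>\<close>: here \<open>w a\<close> is the coset of \<open>a\<close>, and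
  \<open>w a \<le> w b\<close> iff \<open>b / a \<in> \<O>\<close>. The value \<open>w 0 = {0}\<close> is not an element of the value group and
  plays the role of \<open>\<infinity>\<close>.
\<close>

definition ring_units :: "'k::field set \<Rightarrow> 'k set" where
  "ring_units \<O> = {u \<in> \<O>. u \<noteq> 0 \<and> inverse u \<in> \<O>}"

definition assoc_val :: "'k::field set \<Rightarrow> 'k \<Rightarrow> 'k set" where
  "assoc_val \<O> a = {a * u | u. u \<in> ring_units \<O>}"

definition value_group :: "'k::field set \<Rightarrow> 'k set gorder" where
  "value_group \<O> =
     \<lparr> carrier = assoc_val \<O> ` (- {0}),
       eq = (=),
       le = (\<lambda>\<alpha> \<beta>. \<exists>a b. a \<noteq> 0 \<and> b \<noteq> 0 \<and> \<alpha> = assoc_val \<O> a \<and> \<beta> = assoc_val \<O> b \<and> b / a \<in> \<O>) \<rparr>"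

definition value_set :: "'k::field set \<Rightarrow> 'k set \<Rightarrow> 'k set set" where
  "value_set \<O> J = assoc_val \<O> ` (J - {0})"

definition is_value_inf :: "'k::field set \<Rightarrow> 'k set \<Rightarrow> 'k \<Rightarrow> bool" where
  "is_value_inf \<O> J a \<longleftrightarrow>
     greatest (value_group \<O>) (assoc_val \<O> a) (Lower (value_group \<O>) (value_set \<O> J))"

text \<open>
  If the infimum exists, it determines \<open>a\<close> up to a unit of \<open>\<O>\<close>, so for a valuation ring \<open>\<O>\<close>
  the result does not depend on the choice made by \<open>SOME\<close>.
\<close>

definition ideal_hat :: "'k::field set \<Rightarrow> 'k set \<Rightarrow> 'k set" where
  "ideal_hat \<O> J =
     (if \<exists>a. is_value_inf \<O> J a then principal (SOME a. is_value_inf \<O> J a) \<O> else J)"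

definition diamond :: "'k::field set \<Rightarrow> 'k set" where
  "diamond J = ideal_hat (invariance_ring J) J"

end

theory Submission
  imports Defs
begin

text \<open>
  Over a valuation ring every product of ideals consists of plain products. Writing \<open>R = O(IJ)\<close>, the
  ideals \<open>IR\<close> and \<open>JR\<close> both have invariance ring \<open>R\<close>, and \<open>IJ : I = (IR)(JR) : IR\<close>, so one may
  assume \<open>O(I) = R\<close>. If \<open>I = aR\<close>, the quotient is \<open>J\<close>. Otherwise \<open>I = IM\<close> for the maximal ideal \<open>M\<close>
  of \<open>R\<close>. An infimum of \<open>J\<close> attained by \<open>c\<close> means \<open>J = cR\<close> or \<open>J = cM\<close>, and in both cases
  \<open>IJ : I = cI : I = cR\<close>. If \<open>J\<close> has no infimum, then any \<open>a \<notin> J\<close> admits \<open>d\<close> with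
  \<open>J \<subseteq> dR \<subset> aR\<close>; from \<open>aI \<subseteq> IJ \<subseteq> dI\<close> one would get \<open>a/d \<in> O(I) = R\<close>, which is absurd.
\<close>

section \<open>Valuation rings and products of fractional ideals\<close>

lemma frac_idealD:
  assumes "frac_ideal R I"
  shows "0 \<in> I"
    and "x \<in> I \<Longrightarrow> y \<in> I \<Longrightarrow> x + y \<in> I"
    and "c \<in> R \<Longrightarrow> x \<in> I \<Longrightarrow> c * x \<in> I"
  using assms by (auto simp: frac_ideal_def)

text \<open>The arguments run over \<open>val_ring v\<close> and again over the overring
  \<open>invariance_ring (I \<cdot> J)\<close>, hence an abstract ring. Since
  \<open>inverse 0 = 0\<close> and \<open>inverse (-1) = -1\<close>, the last axiom also places 0
  and -1 in \<open>R\<close>.\<close>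

locale valuation_ring =
  fixes R :: "'k::field set"
  assumes one_mem: "1 \<in> R"
    and add_mem: "x \<in> R \<Longrightarrow> y \<in> R \<Longrightarrow> x + y \<in> R"
    and mult_mem: "x \<in> R \<Longrightarrow> y \<in> R \<Longrightarrow> x * y \<in> R"
    and mem_or_inverse_mem: "x \<in> R \<or> inverse x \<in> R"
begin

lemma zero_mem: "0 \<in> R"
  using mem_or_inverse_mem[of 0] by simp

lemma divide_mem_or: "x / y \<in> R \<or> y / x \<in> R"
  using mem_or_inverse_mem[of "x / y"] by simp

text \<open>A multiple of an element of \<open>I\<close> stays in \<open>I\<close>, so
  \<open>x\<close> is no multiple of \<open>y\<close>; divisibility is total, so \<open>y\<close> is
  a multiple of \<open>x\<close>. In terms of values, \<open>x\<close> lies strictly below all of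
  \<open>I\<close>.\<close>

lemma frac_ideal_divide_mem:
  assumes "frac_ideal R I" "x \<notin> I" "y \<in> I"
  shows "y / x \<in> R" "y \<noteq> 0 \<Longrightarrow> x / y \<notin> R"
proof -
  show 1: "x / y \<notin> R" if "y \<noteq> 0"
  proof
    assume "x / y \<in> R"
    then have "x / y * y \<in> I" using assms by (intro frac_idealD(3)[OF assms(1)])
    then show False using assms that by simp
  qed
  show "y / x \<in> R"
    using 1 divide_mem_or[of y x] zero_mem by (cases "y = 0") auto
qed

text \<open>
  Since one of \<open>a / a'\<close> and \<open>a' / a\<close> lies in \<open>R\<close>, a sum \<open>a b + a' b'\<close> is again a single product.
\<close>

lemma products_add:
  assumes I: "frac_ideal R I" and J: "frac_ideal R J"
    and "p \<in> {a * b | a b. a \<in> I \<and> b \<in> J}" "q \<in> {a * b | a b. a \<in> I \<and> b \<in> J}"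
  shows "p + q \<in> {a * b | a b. a \<in> I \<and> b \<in> J}"
proof -
  obtain a b where p: "p = a * b" "a \<in> I" "b \<in> J" using assms by auto
  obtain a' b' where q: "q = a' * b'" "a' \<in> I" "b' \<in> J" using assms by auto
  show ?thesis
  proof (cases "a = 0 \<or> a' = 0")
    case True
    then have "p + q = p \<or> p + q = q" using p q by auto
    then show ?thesis using assms(3,4) by (elim disjE) (simp_all only:)
  next
    case False
    from divide_mem_or[of a a'] show ?thesis
    proof
      assume "a / a' \<in> R"
      then have "a / a' * b + b' \<in> J" using frac_idealD[OF J] p q by blast
      moreover have "p + q = a' * (a / a' * b + b')"
        using False p q by (simp add: field_simps)
      ultimately show ?thesis using q by blast
    next
      assume "a' / a \<in> R"
      then have "b + a' / a * b' \<in> J" using frac_idealD[OF J] p q by blast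
      moreover have "p + q = a * (b + a' / a * b')"
        using False p q by (simp add: field_simps)
      ultimately show ?thesis using p by blast
    qed
  qed
qed

lemma frac_ideal_mult_eq:
  assumes I: "frac_ideal R I" and J: "frac_ideal R J"
  shows "I \<cdot> J = {a * b | a b. a \<in> I \<and> b \<in> J}" (is "_ = ?P")
proof
  have "(\<Sum>i<n. a i * b i) \<in> ?P" if "\<forall>i<n. a i \<in> I \<and> b i \<in> J" for n :: nat and a b
    using that
  proof (induction n)
    case 0
    have "0 = 0 * (0::'k) \<and> 0 \<in> I \<and> 0 \<in> J" using frac_idealD(1) I J by auto
    then show ?case unfolding lessThan_0 sum.empty by blast
  next
    case (Suc n)
    then have "(\<Sum>i<n. a i * b i) \<in> ?P" by simp
    moreover have "a n * b n \<in> ?P" using Suc.prems by blast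
    ultimately show ?case unfolding sum.lessThan_Suc by (rule products_add[OF I J])
  qed
  then show "I \<cdot> J \<subseteq> ?P" unfolding ideal_mult_def by blast
next
  show "?P \<subseteq> I \<cdot> J"
  proof
    fix p assume "p \<in> ?P"
    then obtain a b where "p = a * b" "a \<in> I" "b \<in> J" by auto
    then show "p \<in> I \<cdot> J"
      unfolding ideal_mult_def mem_Collect_eq
      by (intro exI[of _ "Suc 0"] exI[of _ "\<lambda>_. a"] exI[of _ "\<lambda>_. b"]) simp
  qed
qed

lemma ideal_mult_memI:
  "frac_ideal R I \<Longrightarrow> frac_ideal R J \<Longrightarrow> a \<in> I \<Longrightarrow> b \<in> J \<Longrightarrow> a * b \<in> I \<cdot> J"
  using frac_ideal_mult_eq by blast

lemma subset_ideal_quot_mult: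
  assumes "frac_ideal R I" "frac_ideal R J"
  shows "J \<subseteq> ideal_quot (I \<cdot> J) I"
proof
  fix x assume "x \<in> J"
  then have "y * x \<in> I \<cdot> J" if "y \<in> I" for y
    using ideal_mult_memI[OF assms that] by blast
  then show "x \<in> ideal_quot (I \<cdot> J) I" by (simp add: ideal_quot_def mult.commute[of x])
qed

lemma invariance_ring_mult_memI:
  assumes "frac_ideal R I" "frac_ideal R J" "\<And>i j. i \<in> I \<Longrightarrow> j \<in> J \<Longrightarrow> b * (i * j) \<in> I \<cdot> J"
  shows "b \<in> invariance_ring (I \<cdot> J)"
  unfolding invariance_ring_def
proof (intro CollectI ballI)
  fix x assume "x \<in> I \<cdot> J"
  then obtain i j where "x = i * j" "i \<in> I" "j \<in> J"
    unfolding frac_ideal_mult_eq[OF assms(1,2)] by blast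
  then show "b * x \<in> I \<cdot> J" using assms(3) by simp
qed

lemma frac_ideal_mult_commute:
  assumes "frac_ideal R I" "frac_ideal R J"
  shows "I \<cdot> J = J \<cdot> I"
proof -
  have "A \<cdot> B \<subseteq> B \<cdot> A" if AB: "frac_ideal R A" "frac_ideal R B" for A B
  proof
    fix z assume "z \<in> A \<cdot> B"
    then obtain a b where "z = a * b" "a \<in> A" "b \<in> B"
      unfolding frac_ideal_mult_eq[OF AB] by blast
    then show "z \<in> B \<cdot> A" using ideal_mult_memI[OF AB(2,1)] by (simp add: mult.commute[of a])
  qed
  then show ?thesis using assms by blast
qed

text \<open>Values strictly below \<open>I\<close> and \<open>J\<close> add up to one strictly below
  the product: from \<open>x * y = a * b\<close> one gets \<open>b / y = x / a\<close>, where the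
  left side is in \<open>R\<close> and the right side is not. This makes products of ideals proper
  subsets of the field.\<close>

lemma mult_not_mem_frac_ideal_mult:
  assumes I: "frac_ideal R I" "x \<notin> I" and J: "frac_ideal R J" "y \<notin> J"
  shows "x * y \<notin> I \<cdot> J"
proof
  have nz: "x \<noteq> 0" "y \<noteq> 0" using assms by (auto simp: frac_ideal_def)
  assume "x * y \<in> I \<cdot> J"
  then obtain a b where ab: "x * y = a * b" "a \<in> I" "b \<in> J"
    using frac_ideal_mult_eq[OF I(1) J(1)] by auto
  then have "a \<noteq> 0" using nz by auto
  then have "b / y = x / a" using ab nz by (simp add: field_simps)
  moreover have "b / y \<in> R" using frac_ideal_divide_mem[OF J] ab by auto
  moreover have "x / a \<notin> R" using frac_ideal_divide_mem[OF I] ab \<open>a \<noteq> 0\<close> by auto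
  ultimately show False by simp
qed

lemma frac_ideal_mult:
  assumes I: "frac_ideal R I" and J: "frac_ideal R J"
  shows "frac_ideal R (I \<cdot> J)"
proof -
  note eq = frac_ideal_mult_eq[OF I J]
  obtain x y where "x \<notin> I" "y \<notin> J" using I J by (auto simp: frac_ideal_def)
  then have "x * y \<notin> I \<cdot> J" using mult_not_mem_frac_ideal_mult I J by blast
  then have "I \<cdot> J \<noteq> UNIV" by blast
  moreover obtain a where a: "a \<in> I" "a \<noteq> 0" using I by (auto simp: frac_ideal_def)
  obtain b where b: "b \<in> J" "b \<noteq> 0" using J by (auto simp: frac_ideal_def)
  have "a * b \<in> I \<cdot> J" using ideal_mult_memI[OF I J a(1) b(1)] .
  then have "I \<cdot> J \<noteq> {0}" using a b by (metis mult_eq_0_iff singletonD)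
  moreover have "0 \<in> I \<cdot> J"
    using ideal_mult_memI[OF I J frac_idealD(1)[OF I] frac_idealD(1)[OF J]] by simp
  moreover have "c * z \<in> I \<cdot> J" if "c \<in> R" "z \<in> I \<cdot> J" for c z
  proof -
    obtain a b where z: "z = a * b" "a \<in> I" "b \<in> J" using \<open>z \<in> I \<cdot> J\<close> unfolding eq by blast
    then have "(c * a) * b \<in> I \<cdot> J"
      using that by (intro ideal_mult_memI[OF I J] frac_idealD(3)[OF I])
    then show ?thesis using z by (simp add: mult.assoc)
  qed
  moreover have "z + z' \<in> I \<cdot> J" if "z \<in> I \<cdot> J" "z' \<in> I \<cdot> J" for z z'
    using products_add[OF I J] that unfolding eq by blast
  ultimately show ?thesis unfolding frac_ideal_def by blast
qed

section \<open>Invariance rings and the passage to an overring\<close>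

lemma subset_invariance_ring:
  assumes "frac_ideal R I"
  shows "R \<subseteq> invariance_ring I"
  using assms by (auto simp: frac_ideal_def invariance_ring_def)

lemma valuation_ring_invariance_ring:
  assumes "frac_ideal R I"
  shows "valuation_ring (invariance_ring I)"
proof
  show "x \<in> invariance_ring I \<or> inverse x \<in> invariance_ring I" for x
    using subset_invariance_ring[OF assms] mem_or_inverse_mem by blast
qed (use assms in \<open>auto simp: invariance_ring_def frac_ideal_def algebra_simps\<close>)

text \<open>Regarding the invariance ring as an \<open>R\<close>-ideal allows the description by
  single products to be used for \<open>I \<cdot> invariance_ring L\<close>.\<close>

lemma frac_ideal_invariance_ring:
  assumes "frac_ideal R I"
  shows "frac_ideal R (invariance_ring I)"
proof -
  interpret S: valuation_ring "invariance_ring I"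
    using assms by (rule valuation_ring_invariance_ring)
  obtain x y where "x \<in> I" "x \<noteq> 0" "y \<notin> I" using assms by (auto simp: frac_ideal_def)
  \<comment> \<open>The factor \<open>y / x\<close> carries \<open>x\<close> out of
    \<open>I\<close>, so the invariance ring is not the whole field.\<close>
  then have "y / x * x \<notin> I" by simp
  then have "y / x \<notin> invariance_ring I" using \<open>x \<in> I\<close> unfolding invariance_ring_def by blast
  then have "invariance_ring I \<noteq> UNIV" by auto
  moreover have "invariance_ring I \<noteq> {0}" using S.one_mem by auto
  ultimately show ?thesis
    using S.zero_mem S.add_mem S.mult_mem subset_invariance_ring[OF assms]
    by (auto simp: frac_ideal_def)
qed

lemma frac_ideal_mult_overring:
  assumes I: "frac_ideal R I" and L: "frac_ideal R L"
  defines "S \<equiv> invariance_ring L"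
  shows "frac_ideal S (I \<cdot> S)"
proof -
  interpret S: valuation_ring S
    unfolding S_def using L by (rule valuation_ring_invariance_ring)
  have S: "frac_ideal R S" unfolding S_def using L by (rule frac_ideal_invariance_ring)
  have "c * z \<in> I \<cdot> S" if "c \<in> S" "z \<in> I \<cdot> S" for c z
  proof -
    obtain a s where "z = a * s" "a \<in> I" "s \<in> S"
      using \<open>z \<in> I \<cdot> S\<close> unfolding frac_ideal_mult_eq[OF I S] by blast
    then have "c * z = a * (c * s)" "c * s \<in> S" using that S.mult_mem by auto
    then show ?thesis using frac_ideal_mult_eq[OF I S] \<open>a \<in> I\<close> by blast
  qed
  then show ?thesis using frac_ideal_mult[OF I S] by (auto simp: frac_ideal_def)
qed

text \<open>\<open>S\<close> leaves \<open>I \<cdot> J\<close> invariant. Hence if \<open>b\<close>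
  maps \<open>I \<cdot> S\<close> into itself, multiplying by \<open>J\<close> shows that
  \<open>b\<close> maps \<open>I \<cdot> J\<close> into itself, so \<open>b\<close> is in
  \<open>S\<close>.\<close>

lemma invariance_ring_mult_overring:
  assumes I: "frac_ideal R I" and J: "frac_ideal R J"
  defines "S \<equiv> invariance_ring (I \<cdot> J)"
  shows "invariance_ring (I \<cdot> S) = S"
proof
  note IJ = frac_ideal_mult[OF I J]
  interpret S: valuation_ring S
    unfolding S_def using IJ by (rule valuation_ring_invariance_ring)
  have S: "frac_ideal R S" unfolding S_def using IJ by (rule frac_ideal_invariance_ring)
  show "S \<subseteq> invariance_ring (I \<cdot> S)"
    using frac_ideal_mult_overring[OF I IJ]
    by (auto simp: frac_ideal_def S_def invariance_ring_def[of "I \<cdot> _"])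
  show "invariance_ring (I \<cdot> S) \<subseteq> S"
  proof
    fix b assume b: "b \<in> invariance_ring (I \<cdot> S)"
    have "b * (i * j) \<in> I \<cdot> J" if "i \<in> I" "j \<in> J" for i j
    proof -
      have "i * 1 \<in> I \<cdot> S" using that S.one_mem frac_ideal_mult_eq[OF I S] by blast
      then have "b * i \<in> I \<cdot> S" using b by (auto simp: invariance_ring_def)
      then obtain i' s where "b * i = i' * s" "i' \<in> I" "s \<in> S"
        unfolding frac_ideal_mult_eq[OF I S] by blast
      moreover from this have "i' * j \<in> I \<cdot> J" using that frac_ideal_mult_eq[OF I J] by blast
      ultimately have "s * (i' * j) \<in> I \<cdot> J" by (auto simp: S_def invariance_ring_def)
      moreover have "b * (i * j) = s * (i' * j)"
        using arg_cong[OF \<open>b * i = i' * s\<close>, of "\<lambda>t. t * j"] by (simp only: ac_simps)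
      ultimately show ?thesis by (simp only:)
    qed
    then show "b \<in> S" unfolding S_def by (rule invariance_ring_mult_memI[OF I J])
  qed
qed

text \<open>The product \<open>I \<cdot> J\<close> absorbs \<open>S\<close>: enlarging both factors
  by \<open>S\<close> does not change it, and a factor carrying \<open>I\<close> into it also
  carries \<open>I \<cdot> S\<close> into it. The problem thereby moves to
  \<open>S\<close>-ideals.\<close>

lemma ideal_quot_mult_overring:
  assumes I: "frac_ideal R I" and J: "frac_ideal R J"
  defines "S \<equiv> invariance_ring (I \<cdot> J)"
  shows "ideal_quot (I \<cdot> J) I = ideal_quot ((I \<cdot> S) \<cdot> (J \<cdot> S)) (I \<cdot> S)"
proof -
  note IJ = frac_ideal_mult[OF I J]
  interpret S: valuation_ring S
    unfolding S_def using IJ by (rule valuation_ring_invariance_ring)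
  have S: "frac_ideal R S" unfolding S_def using IJ by (rule frac_ideal_invariance_ring)
  note eqI = frac_ideal_mult_eq[OF I S] and eqJ = frac_ideal_mult_eq[OF J S]
    and eqIJ = frac_ideal_mult_eq[OF I J]
    and eq = frac_ideal_mult_eq[OF frac_ideal_mult[OF I S] frac_ideal_mult[OF J S]]
  have S_IJ: "s * z \<in> I \<cdot> J" if "s \<in> S" "z \<in> I \<cdot> J" for s z
    using that by (simp add: S_def invariance_ring_def)
  have subI: "I \<subseteq> I \<cdot> S" and subJ: "J \<subseteq> J \<cdot> S"
    unfolding eqI eqJ using S.one_mem by force+
  have "(I \<cdot> S) \<cdot> (J \<cdot> S) = I \<cdot> J"
  proof
    show "I \<cdot> J \<subseteq> (I \<cdot> S) \<cdot> (J \<cdot> S)" unfolding eq eqIJ using subI subJ by blast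
    show "(I \<cdot> S) \<cdot> (J \<cdot> S) \<subseteq> I \<cdot> J"
    proof
      fix z assume "z \<in> (I \<cdot> S) \<cdot> (J \<cdot> S)"
      then obtain x y where "z = x * y" "x \<in> I \<cdot> S" "y \<in> J \<cdot> S"
        unfolding eq by blast
      then obtain i s j t where z: "z = (i * s) * (j * t)" "i \<in> I" "s \<in> S" "j \<in> J" "t \<in> S"
        unfolding eqI eqJ by blast
      then have "i * j \<in> I \<cdot> J" unfolding eqIJ by blast
      then have "s * (t * (i * j)) \<in> I \<cdot> J" using z S_IJ by blast
      then show "z \<in> I \<cdot> J" using z by (simp add: ac_simps)
    qed
  qed
  moreover have "ideal_quot (I \<cdot> J) I = ideal_quot (I \<cdot> J) (I \<cdot> S)"
  proof
    show "ideal_quot (I \<cdot> J) (I \<cdot> S) \<subseteq> ideal_quot (I \<cdot> J) I"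
      using subI by (auto simp: ideal_quot_def)
    show "ideal_quot (I \<cdot> J) I \<subseteq> ideal_quot (I \<cdot> J) (I \<cdot> S)"
    proof
      fix a assume a: "a \<in> ideal_quot (I \<cdot> J) I"
      have "a * (i * s) \<in> I \<cdot> J" if "i \<in> I" "s \<in> S" for i s
      proof -
        have "s * (a * i) \<in> I \<cdot> J" using a that S_IJ by (simp add: ideal_quot_def)
        moreover have "s * (a * i) = a * (i * s)" by (simp only: ac_simps)
        ultimately show ?thesis by (simp only:)
      qed
      then show "a \<in> ideal_quot (I \<cdot> J) (I \<cdot> S)"
        unfolding ideal_quot_def eqI by auto
    qed
  qed
  ultimately show ?thesis by simp
qed

lemma invariance_ring_mult:
  assumes I: "frac_ideal R I" and J: "frac_ideal R J"
    and same: "invariance_ring I = invariance_ring J"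
  shows "invariance_ring (I \<cdot> J) = invariance_ring I"
proof
  show "invariance_ring I \<subseteq> invariance_ring (I \<cdot> J)"
  proof
    fix b assume b: "b \<in> invariance_ring I"
    have "b * (i * j) \<in> I \<cdot> J" if "i \<in> I" "j \<in> J" for i j
    proof -
      have "b * i \<in> I" using b that by (simp add: invariance_ring_def)
      then have "(b * i) * j \<in> I \<cdot> J" using that ideal_mult_memI[OF I J] by blast
      then show ?thesis by (simp add: mult.assoc)
    qed
    then show "b \<in> invariance_ring (I \<cdot> J)" by (rule invariance_ring_mult_memI[OF I J])
  qed
  show "invariance_ring (I \<cdot> J) \<subseteq> invariance_ring I"
  proof
    fix b assume b: "b \<in> invariance_ring (I \<cdot> J)"
    show "b \<in> invariance_ring I"
    proof (rule ccontr)
      assume "b \<notin> invariance_ring I"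
      then obtain x where x: "x \<in> I" "b * x \<notin> I" by (auto simp: invariance_ring_def)
      obtain y where y: "y \<in> J" "b * y \<notin> J"
        using \<open>b \<notin> invariance_ring I\<close> unfolding same by (auto simp: invariance_ring_def)
      \<comment> \<open>Applying \<open>b\<close> twice keeps \<open>x * y\<close> in the product,
        but giving one factor \<open>b\<close> to \<open>x\<close> and the other to \<open>y\<close>
        leaves both ideals.\<close>
      have "x * y \<in> I \<cdot> J" using x y ideal_mult_memI[OF I J] by blast
      then have "b * (b * (x * y)) \<in> I \<cdot> J" using b by (simp add: invariance_ring_def)
      then show False
        using mult_not_mem_frac_ideal_mult[OF I x(2) J y(2)] by (simp add: ac_simps)
    qed
  qed
qed

lemma frac_ideal_mult_invariance_ring:
  assumes I: "frac_ideal R I"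
  shows "I \<cdot> invariance_ring I = I"
proof -
  note S = frac_ideal_invariance_ring[OF I]
  have "1 \<in> invariance_ring I" by (simp add: invariance_ring_def)
  then have "x * 1 \<in> I \<cdot> invariance_ring I" if "x \<in> I" for x
    using ideal_mult_memI[OF I S that] by blast
  then have "I \<subseteq> I \<cdot> invariance_ring I" by auto
  moreover have "I \<cdot> invariance_ring I \<subseteq> I"
  proof
    fix x assume "x \<in> I \<cdot> invariance_ring I"
    then obtain a s where "x = a * s" "a \<in> I" "s \<in> invariance_ring I"
      unfolding frac_ideal_mult_eq[OF I S] by blast
    then show "x \<in> I" by (simp add: invariance_ring_def mult.commute)
  qed
  ultimately show ?thesis by blast
qed

section \<open>The value group expressed through divisibility in \<open>R\<close>\<close>

lemma assoc_val_eq_iff: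
  assumes "a \<noteq> 0" "b \<noteq> 0"
  shows "assoc_val R a = assoc_val R b \<longleftrightarrow> b / a \<in> R \<and> a / b \<in> R"
proof
  have "1 \<in> ring_units R" using one_mem by (simp add: ring_units_def)
  then have "a \<in> assoc_val R a" "b \<in> assoc_val R b" by (force simp: assoc_val_def)+
  moreover assume "assoc_val R a = assoc_val R b"
  ultimately have "a \<in> assoc_val R b" by simp
  then obtain u where "a = b * u" "u \<in> R" "inverse u \<in> R" "u \<noteq> 0"
    by (auto simp: assoc_val_def ring_units_def)
  then show "b / a \<in> R \<and> a / b \<in> R" using assms by (simp add: field_simps)
next
  assume *: "b / a \<in> R \<and> a / b \<in> R"
  have sub: "assoc_val R x \<subseteq> assoc_val R y"
    if "x \<noteq> 0" "y \<noteq> 0" "x / y \<in> R" "y / x \<in> R" for x y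
  proof
    fix z assume "z \<in> assoc_val R x"
    then obtain u where u: "z = x * u" "u \<in> R" "inverse u \<in> R" "u \<noteq> 0"
      by (auto simp: assoc_val_def ring_units_def)
    have "inverse (x / y * u) = y / x * inverse u" using that u by (simp add: field_simps)
    moreover have "x / y * u \<in> R" "y / x * inverse u \<in> R"
      using that u by (intro mult_mem; simp)+
    moreover have "x / y * u \<noteq> 0" using that u by simp
    ultimately have "x / y * u \<in> ring_units R"
      unfolding ring_units_def by (metis (mono_tags, lifting) mem_Collect_eq)
    moreover have "z = y * (x / y * u)" using that u by simp
    ultimately show "z \<in> assoc_val R y" unfolding assoc_val_def by blast
  qed
  show "assoc_val R a = assoc_val R b" using sub[of a b] sub[of b a] * assms by blast
qed

lemma assoc_val_le_iff:
  assumes "a \<noteq> 0" "b \<noteq> 0"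
  shows "le (value_group R) (assoc_val R a) (assoc_val R b) \<longleftrightarrow> b / a \<in> R"
proof
  assume "le (value_group R) (assoc_val R a) (assoc_val R b)"
  then obtain a' b' where *: "a' \<noteq> 0" "b' \<noteq> 0" "assoc_val R a = assoc_val R a'"
      "assoc_val R b = assoc_val R b'" "b' / a' \<in> R"
    by (auto simp: value_group_def)
  then have "b / b' \<in> R" "a' / a \<in> R"
    using assoc_val_eq_iff assms by blast+
  \<comment> \<open>The order is defined through some pair of representatives; the outer factors
    exchange them for \<open>a\<close> and \<open>b\<close>.\<close>
  then have "b / b' * (b' / a') * (a' / a) \<in> R" using * mult_mem by blast
  then show "b / a \<in> R" using * by simp
qed (use assms in \<open>auto simp: value_group_def\<close>)

lemma assoc_val_mem_carrier_iff: "assoc_val R a \<in> carrier (value_group R) \<longleftrightarrow> a \<noteq> 0"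
proof -
  have "1 \<in> ring_units R" using one_mem by (simp add: ring_units_def)
  then have "x \<in> assoc_val R x" for x by (force simp: assoc_val_def)
  moreover have "assoc_val R 0 \<subseteq> {0}" by (auto simp: assoc_val_def)
  ultimately show ?thesis by (fastforce simp: value_group_def)
qed

text \<open>Lower bounds of the value set correspond to the \<open>d\<close> with
  \<open>J \<subseteq> principal d R\<close>, and larger bounds to smaller ideals. An infimum is
  thus a generator of the smallest principal ideal containing \<open>J\<close>.\<close>

lemma is_value_inf_iff:
  "is_value_inf R J a \<longleftrightarrow>
     a \<noteq> 0 \<and> (\<forall>x\<in>J. x / a \<in> R) \<and> (\<forall>d. d \<noteq> 0 \<longrightarrow> (\<forall>x\<in>J. x / d \<in> R) \<longrightarrow> a / d \<in> R)"
proof -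
  have lower: "assoc_val R d \<in> Lower (value_group R) (value_set R J) \<longleftrightarrow>
      d \<noteq> 0 \<and> (\<forall>x\<in>J. x / d \<in> R)" for d
  proof (cases "d = 0")
    case True
    then show ?thesis using assoc_val_mem_carrier_iff[of d] by (simp add: Lower_def)
  next
    case False
    have "assoc_val R d \<in> Lower (value_group R) (value_set R J) \<longleftrightarrow>
        (\<forall>x\<in>J - {0}. le (value_group R) (assoc_val R d) (assoc_val R x))"
      using False by (auto simp: Lower_def value_set_def assoc_val_mem_carrier_iff)
    \<comment> \<open>The element 0 has no value but may be readmitted, since
      \<open>0 / d = 0\<close> is in \<open>R\<close>.\<close>
    also have "\<dots> \<longleftrightarrow> (\<forall>x\<in>J. x / d \<in> R)"
      using False zero_mem by (auto simp: assoc_val_le_iff)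
    finally show ?thesis using False by simp
  qed
  have sub: "Lower (value_group R) (value_set R J) \<subseteq> assoc_val R ` (- {0})"
    by (auto simp: Lower_def value_group_def)
  have car: "Lower (value_group R) (value_set R J) \<subseteq> carrier (value_group R)"
    by (auto simp: Lower_def)
  show ?thesis
  proof (cases "a \<noteq> 0 \<and> (\<forall>x\<in>J. x / a \<in> R)")
    case False
    then show ?thesis using lower[of a] by (auto simp: is_value_inf_def greatest_def)
  next
    case True
    have "is_value_inf R J a \<longleftrightarrow> (\<forall>\<beta>\<in>Lower (value_group R) (value_set R J).
        le (value_group R) \<beta> (assoc_val R a))"
      using True lower[of a] car by (simp add: is_value_inf_def greatest_def)
    also have "\<dots> \<longleftrightarrow> (\<forall>d. assoc_val R d \<in> Lower (value_group R) (value_set R J) \<longrightarrow>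
        le (value_group R) (assoc_val R d) (assoc_val R a))"
      using sub by blast
    also have "\<dots> \<longleftrightarrow> (\<forall>d. d \<noteq> 0 \<longrightarrow> (\<forall>x\<in>J. x / d \<in> R) \<longrightarrow> a / d \<in> R)"
      using True lower assoc_val_le_iff by auto
    finally show ?thesis using True by simp
  qed
qed

lemma mem_principal_iff: "a \<noteq> 0 \<Longrightarrow> x \<in> principal a R \<longleftrightarrow> x / a \<in> R"
  by (auto simp: principal_def intro!: exI[of _ "x / a"])

section \<open>The quotient when \<open>R\<close> is the invariance ring of \<open>I\<close>\<close>

lemma ideal_quot_mult_principal:
  assumes I: "frac_ideal R I" and J: "frac_ideal R J" and a: "I = principal a R"
  shows "ideal_quot (I \<cdot> J) I = J"
proof
  note eq = frac_ideal_mult_eq[OF I J]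
  have "a \<in> I" using one_mem unfolding a by (force simp: principal_def)
  have "I \<noteq> {0}" using I by (simp add: frac_ideal_def)
  then have "a \<noteq> 0" using one_mem unfolding a by (auto simp: principal_def)
  show "J \<subseteq> ideal_quot (I \<cdot> J) I" by (rule subset_ideal_quot_mult[OF I J])
  show "ideal_quot (I \<cdot> J) I \<subseteq> J"
  proof
    fix x assume "x \<in> ideal_quot (I \<cdot> J) I"
    then have "x * a \<in> I \<cdot> J" using \<open>a \<in> I\<close> by (simp add: ideal_quot_def)
    then obtain i j where "x * a = i * j" "i \<in> I" "j \<in> J" unfolding eq by blast
    moreover from this obtain r where "i = a * r" "r \<in> R" unfolding a principal_def by blast
    ultimately have "x = r * j" "r * j \<in> J" using \<open>a \<noteq> 0\<close> frac_idealD(3)[OF J] by auto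
    then show "x \<in> J" by simp
  qed
qed

text \<open>If \<open>J\<close> lies in \<open>d R\<close>, then \<open>I \<cdot> J\<close> lies in
  \<open>d I\<close>; so \<open>a I\<close> lies in \<open>d I\<close>, and \<open>a / d\<close>
  belongs to the invariance ring of \<open>I\<close>, which is \<open>R\<close>.\<close>

lemma ideal_quot_mult_lower_bound:
  assumes I: "frac_ideal R I" and J: "frac_ideal R J" and inv: "invariance_ring I = R"
    and d: "d \<noteq> 0" "\<And>x. x \<in> J \<Longrightarrow> x / d \<in> R" and a: "a \<in> ideal_quot (I \<cdot> J) I"
  shows "a / d \<in> R"
proof -
  have "a / d * x \<in> I" if "x \<in> I" for x
  proof -
    have "a * x \<in> I \<cdot> J" using a that by (simp add: ideal_quot_def)
    then obtain i j where ij: "a * x = i * j" "i \<in> I" "j \<in> J"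
      unfolding frac_ideal_mult_eq[OF I J] by blast
    then have "j / d * i \<in> I" using d by (intro frac_idealD(3)[OF I])
    moreover have "a / d * x = j / d * i" using ij by (simp add: mult.commute)
    ultimately show ?thesis by (simp only:)
  qed
  then show ?thesis using inv by (auto simp: invariance_ring_def)
qed

text \<open>The infimum \<open>c\<close> is itself a lower bound, which gives the upper inclusion.
  The other one amounts to \<open>c I\<close> lying in \<open>I \<cdot> J\<close>; here the absence
  of a generator of \<open>I\<close> enters.\<close>

lemma ideal_quot_mult_nonprincipal_inf:
  assumes I: "frac_ideal R I" and J: "frac_ideal R J" and inv: "invariance_ring I = R"
    and nonprincipal: "\<And>a. I \<noteq> principal a R" and c: "is_value_inf R J c"
  shows "ideal_quot (I \<cdot> J) I = principal c R"
proof -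
  note eq = frac_ideal_mult_eq[OF I J]
  have c: "c \<noteq> 0" "\<And>x. x \<in> J \<Longrightarrow> x / c \<in> R"
    "\<And>d. d \<noteq> 0 \<Longrightarrow> (\<forall>x\<in>J. x / d \<in> R) \<Longrightarrow> c / d \<in> R"
    using c by (auto simp: is_value_inf_iff)
  have RI: "r * x \<in> I" if "r \<in> R" "x \<in> I" for r x using that I by (auto simp: frac_ideal_def)
  text \<open>As \<open>I\<close> has no generator, \<open>x = m y\<close> with \<open>y \<in> I\<close> and \<open>m\<close> a nonunit of \<open>R\<close>, so \<open>c m \<in> J\<close>.\<close>
  have cI: "c * x \<in> I \<cdot> J" if x: "x \<in> I" for x
  proof -
    obtain y where y: "y \<in> I" "y \<noteq> 0" "x / y \<in> R" "y / x \<notin> R \<or> x = 0"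
    proof (cases "x = 0")
      case True
      moreover obtain y where "y \<in> I" "y \<noteq> 0" using I by (auto simp: frac_ideal_def)
      ultimately show ?thesis using that zero_mem by auto
    next
      case False
      have "principal x R \<subseteq> I" using RI x by (auto simp: principal_def mult.commute)
      then obtain y where y: "y \<in> I" "y \<notin> principal x R" using nonprincipal[of x] by blast
      then have "y / x \<notin> R" using mem_principal_iff[OF False] by simp
      moreover from this have "y \<noteq> 0" using zero_mem by auto
      ultimately show ?thesis using that y divide_mem_or[of x y] by blast
    qed
    \<comment> \<open>Otherwise \<open>c * (x / y)\<close> would be a lower bound for
      \<open>J\<close>, and comparison with the infimum \<open>c\<close> would put
      \<open>y / x\<close> in \<open>R\<close>.\<close>
    have "c * (x / y) \<in> J"
    proof (rule ccontr)
      assume notin: "c * (x / y) \<notin> J"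
      then have "x \<noteq> 0" using J by (auto simp: frac_ideal_def)
      have "c / (c * (x / y)) \<in> R"
        using c(1) \<open>x \<noteq> 0\<close> y(2) frac_ideal_divide_mem(1)[OF J notin] by (intro c(3)) auto
      then show False using c(1) \<open>x \<noteq> 0\<close> y by simp
    qed
    moreover have "c * x = y * (c * (x / y))" using y by simp
    ultimately show ?thesis unfolding eq using y by blast
  qed
  show ?thesis
  proof
    show "principal c R \<subseteq> ideal_quot (I \<cdot> J) I"
    proof
      fix z assume "z \<in> principal c R"
      then obtain r where r: "z = c * r" "r \<in> R" by (auto simp: principal_def)
      then have "z * x \<in> I \<cdot> J" if "x \<in> I" for x
        using cI[of "r * x"] RI that by (simp add: mult.assoc)
      then show "z \<in> ideal_quot (I \<cdot> J) I" by (simp add: ideal_quot_def)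
    qed
    show "ideal_quot (I \<cdot> J) I \<subseteq> principal c R"
      using ideal_quot_mult_lower_bound[OF I J inv] c mem_principal_iff by blast
  qed
qed

lemma ideal_quot_mult_no_inf:
  assumes I: "frac_ideal R I" and J: "frac_ideal R J" and inv: "invariance_ring I = R"
    and no_inf: "\<And>a. \<not> is_value_inf R J a"
  shows "ideal_quot (I \<cdot> J) I = J"
proof
  show "J \<subseteq> ideal_quot (I \<cdot> J) I" by (rule subset_ideal_quot_mult[OF I J])
  show "ideal_quot (I \<cdot> J) I \<subseteq> J"
  proof (rule ccontr)
    assume "\<not> ?thesis"
    then obtain a where a: "a \<in> ideal_quot (I \<cdot> J) I" "a \<notin> J" by blast
    have "a \<noteq> 0" using a J by (auto simp: frac_ideal_def)
    \<comment> \<open>Being outside \<open>J\<close>, the element \<open>a\<close> is a lower bound;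
      as it is not the greatest one, some bound \<open>d\<close> is not below it.\<close>
    then obtain d where "d \<noteq> 0" "\<And>x. x \<in> J \<Longrightarrow> x / d \<in> R" "a / d \<notin> R"
      using no_inf[of a] frac_ideal_divide_mem(1)[OF J a(2)] by (auto simp: is_value_inf_iff)
    then show False using ideal_quot_mult_lower_bound[OF I J inv] a by blast
  qed
qed

text \<open>The hat is taken over \<open>R\<close>; it becomes \<open>diamond J\<close> once
  \<open>R\<close> is also the invariance ring of \<open>J\<close>. The case with an infimum holds
  for every choice of it, in particular for the one made by \<open>SOME\<close>.\<close>

lemma ideal_quot_mult_eq:
  assumes I: "frac_ideal R I" and J: "frac_ideal R J" and inv: "invariance_ring I = R"
  shows "ideal_quot (I \<cdot> J) I = (if principal_ideal R I then J else ideal_hat R J)"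
proof (cases "principal_ideal R I")
  case True
  then obtain a where "I = principal a R" by (auto simp: principal_ideal_def)
  then show ?thesis using True ideal_quot_mult_principal[OF I J] by simp
next
  case False
  then have "I \<noteq> principal a R" for a using I by (auto simp: principal_ideal_def)
  then show ?thesis
    using False ideal_quot_mult_nonprincipal_inf[OF I J inv, OF _ someI_ex[of "is_value_inf R J"]]
      ideal_quot_mult_no_inf[OF I J inv]
    by (auto simp: ideal_hat_def)
qed

end

section \<open>The ring of a valuation, and assembly of the result\<close>

lemma valuation_ring_val_ring:
  assumes v: "valuation v"
  shows "valuation_ring (val_ring v)"
proof
  have mult: "v (x * y) = v x + v y" if "x \<noteq> 0" "y \<noteq> 0" for x y
    using v that by (auto simp: valuation_def)
  have add: "min (v x) (v y) \<le> v (x + y)" if "x \<noteq> 0" "y \<noteq> 0" "x + y \<noteq> 0" for x y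
    using v that by (auto simp: valuation_def)
  have one: "v 1 = 0" using mult[of 1 1] by simp
  then show "1 \<in> val_ring v" by (simp add: val_ring_def)
  show "x + y \<in> val_ring v" if "x \<in> val_ring v" "y \<in> val_ring v" for x y
  \<comment> \<open>As \<open>v 0\<close> is unconstrained, vanishing terms are split off before the
    inequality for \<open>v\<close> is applied.\<close>
  proof (cases "x = 0 \<or> y = 0 \<or> x + y = 0")
    case True
    then show ?thesis using that by (auto simp: val_ring_def)
  next
    case False
    then have "0 \<le> min (v x) (v y)" using that by (simp add: val_ring_def)
    also have "\<dots> \<le> v (x + y)" using add False by blast
    finally show ?thesis by (simp add: val_ring_def)
  qed
  show "x * y \<in> val_ring v" if "x \<in> val_ring v" "y \<in> val_ring v" for x y
    using that mult[of x y] add_nonneg_nonneg[of "v x" "v y"]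
    by (cases "x = 0 \<or> y = 0") (auto simp: val_ring_def)
  show "x \<in> val_ring v \<or> inverse x \<in> val_ring v" for x
  proof (cases "x = 0")
    case False
    then have "v x + v (inverse x) = 0" using mult[of x "inverse x"] one by simp
    then have "v (inverse x) = - v x" by (simp add: eq_neg_iff_add_eq_0 add.commute)
    then show ?thesis using linear[of 0 "v x"] by (auto simp: val_ring_def)
  qed (simp add: val_ring_def)
qed

theorem theorem3p15:
  fixes v :: "'k::field \<Rightarrow> 'g::linordered_ab_group_add"
    and I J :: "'k set"
  assumes "valuation v"
    and "frac_ideal (val_ring v) I"
    and "frac_ideal (val_ring v) J"
  shows "ideal_quot (I \<cdot> J) I =
           (if principal_ideal (invariance_ring (I \<cdot> J)) (I \<cdot> invariance_ring (I \<cdot> J))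
            then J \<cdot> invariance_ring (I \<cdot> J)
            else diamond (J \<cdot> invariance_ring (I \<cdot> J)))
       \<and> (invariance_ring I = invariance_ring J \<longrightarrow>
            invariance_ring (I \<cdot> J) = invariance_ring I
          \<and> I \<cdot> invariance_ring (I \<cdot> J) = I
          \<and> J \<cdot> invariance_ring (I \<cdot> J) = J
          \<and> ideal_quot (I \<cdot> J) I =
              (if principal_ideal (invariance_ring I) I then J else diamond J))"
proof -
  let ?S = "invariance_ring (I \<cdot> J)"
  note I = assms(2) and J = assms(3)
  interpret valuation_ring "val_ring v" using assms(1) by (rule valuation_ring_val_ring)
  note IJ = frac_ideal_mult[OF I J]
  interpret S: valuation_ring ?S using IJ by (rule valuation_ring_invariance_ring)
  \<comment> \<open>By symmetry in \<open>I\<close> and \<open>J\<close>. This identifies the hat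
    over \<open>?S\<close> with \<open>diamond (J \<cdot> ?S)\<close>.\<close>
  have "invariance_ring (J \<cdot> ?S) = ?S"
    using invariance_ring_mult_overring[OF J I] frac_ideal_mult_commute[OF I J] by simp
  then have main: "ideal_quot (I \<cdot> J) I =
      (if principal_ideal ?S (I \<cdot> ?S) then J \<cdot> ?S else diamond (J \<cdot> ?S))"
    using S.ideal_quot_mult_eq[OF frac_ideal_mult_overring[OF I IJ]
        frac_ideal_mult_overring[OF J IJ] invariance_ring_mult_overring[OF I J]]
      ideal_quot_mult_overring[OF I J]
    by (simp add: diamond_def)
  \<comment> \<open>Substituting these equalities into the general formula gives the special
    case.\<close>
  moreover have "?S = invariance_ring I \<and> I \<cdot> ?S = I \<and> J \<cdot> ?S = J"
    if "invariance_ring I = invariance_ring J"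
    using invariance_ring_mult[OF I J that] frac_ideal_mult_invariance_ring[OF I]
      frac_ideal_mult_invariance_ring[OF J] that by simp
  ultimately show ?thesis by auto
qed

end
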